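(* Consider $n\ge 2$ agents in the plane satisfying all the standing assumptions listed in the context (graph, feasibility of the desired heading and angles, $\mathbf b_1(0)\neq-\mathbf b_1^*$, and $\alpha_{21}^*\notin\{0,\pi\}$ modulo $2\pi$), and let the unit heading vectors $\mathbf b_1(t),\dots,\mathbf b_n(t)\in\mathbb R^2$ evolve according to $$\dot{\mathbf b}_1=\mathbf P_{\mathbf b_1}\mathbf b_1^*,\qquad \dot{\mathbf b}_i=\mathbf P_{\mathbf b_i}\sum_{j\in\mathcal N_i}\mathbf R(\alpha_{ij}^* )\,\mathbf b_j,\quad i=2,\dots,n .$$ Then, for almost all initial conditions $(\mathbf b_1(0),\dots,\mathbf b_n(0))\in(S^1)^n$ (with respect to Lebesgue measure on the product of $n$ unit circles), the headings asymptotically target a common point: there is a point $\mathbf p^*\in\mathbb R^2$ such that $\mathbf b_i(t)\to(\mathbf p^*-\mathbf p_i)/\|\mathbf p^*-\mathbf p_i\|$ as $t\to\infty$ for every $i=1,\dots,n$; that is, $\mathbf b_1(t)\to\mathbf b_1^*$ and $\mathbf b_i(t)-\mathbf R(\alpha_{ij}^* )\mathbf b_j(t)\to\mathbf 0$ as $t\to\infty$ for every $i\in\{2,\dots,n\}$ and every $j\in\mathcal N_i$.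
   Context: Notation. $\mathbf R(\alpha)=\begin{bmatrix}\cos\alpha&-\sin\alpha\\ \sin\alpha&\cos\alpha\end{bmatrix}$ is the counterclockwise rotation of the plane by the angle $\alpha$. For a unit vector $\mathbf b\in\mathbb R^2$, $\mathbf P_{\mathbf b}=\mathbf I_2-\mathbf b\mathbf b^{T}$ is the orthogonal projection onto the orthogonal complement of $\mathbf b$. $S^1$ is the unit circle in $\mathbb R^2$. Setting. There are $n\ge2$ agents; agent $i$ sits at a fixed position $\mathbf p_i\in\mathbb R^2$ and has a heading $\mathbf b_i\in S^1$; all vectors are expressed in a common coordinate frame. Standing assumptions. (1) Graph. Communication is described by a directed graph $\mathcal G=(\mathcal V,\mathcal E)$, $\mathcal V=\{1,\dots,n\}$, where $(j,i)\in\mathcal E$ means that $i$ receives information from $j$. The in-neighbor set of $i$ is $\mathcal N_i=\{j:(j,i)\in\mathcal E\}$. The graph is rooted out-branching with root $1$: there is a directed path from vertex $1$ to every other vertex. The graph is moreover acyclic and its vertices are labelled so that $\mathcal N_1=\emptyset$ and $\emptyset\ne\mathcal N_i\subseteq\{1,\dots,i-1\}$ for $i\ge2$ (in particular $\mathcal N_2=\{1\}$). (2) Feasibility. A unit vector $\mathbf b_1^*$ (desired heading of agent 1) and desired angles $\alpha_{ij}^*\in(-\pi,\pi]$ ($i\ge2$, $j\in\mathcal N_i$) are given, and there exists $\mathbf p^*\in\mathbb R^2$, different from all $\mathbf p_i$, such that $\mathbf b_1^*=(\mathbf p^*-\mathbf p_1)/\|\mathbf p^*-\mathbf p_1\|$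 and $\frac{\mathbf p^*-\mathbf p_i}{\|\mathbf p^*-\mathbf p_i\|}=\mathbf R(\alpha_{ij}^* )\frac{\mathbf p^*-\mathbf p_j}{\|\mathbf p^*-\mathbf p_j\|}$ for all $i\ge2$ and $j\in\mathcal N_i$. (3) $\mathbf b_1(0)\ne-\mathbf b_1^*$, and $\alpha_{21}^*\notin\{0,\pi\}$ modulo $2\pi$. *)

theory Defs
  imports "HOL-Analysis.Analysis"
begin

definition rot :: "real \<Rightarrow> real^2^2" where
  "rot a = vector [vector [cos a, - sin a], vector [sin a, cos a]]"

text \<open>The matrix \<open>I - b b\<^sup>T\<close>; it is an orthogonal projection only if \<open>b\<close> is a unit vector.\<close>

definition perp_proj :: "real^2 \<Rightarrow> real^2^2" where
  "perp_proj b = mat 1 - (\<chi> i j. b $ i * b $ j)"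

text \<open>A directed graph is given by its edge set; \<open>(j, i) \<in> E\<close> means that \<open>i\<close> receives
  information from \<open>j\<close>.\<close>

definition in_nbrs :: "(nat \<times> nat) set \<Rightarrow> nat \<Rightarrow> nat set" where
  "in_nbrs E i = {j. (j, i) \<in> E}"

text \<open>The headings \<open>b i\<close> are only meaningful for agents \<open>i \<in> {1..n}\<close> and times \<open>t \<ge> 0\<close>;
  at \<open>t = 0\<close> the derivative is one-sided.\<close>

definition heading_solution ::
  "nat \<Rightarrow> (nat \<times> nat) set \<Rightarrow> real^2 \<Rightarrow> (nat \<Rightarrow> nat \<Rightarrow> real) \<Rightarrow> (nat \<Rightarrow> real \<Rightarrow> real^2) \<Rightarrow> bool" where
  "heading_solution n E bstar \<alpha> b \<longleftrightarrow>
     (\<forall>i\<in>{1..n}. \<forall>t\<ge>0. norm (b i t) = 1) \<and>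
     (\<forall>t\<ge>0. (b 1 has_vector_derivative perp_proj (b 1 t) *v bstar) (at t within {0..})) \<and>
     (\<forall>i\<in>{2..n}. \<forall>t\<ge>0.
        (b i has_vector_derivative
           perp_proj (b i t) *v (\<Sum>j\<in>in_nbrs E i. rot (\<alpha> i j) *v b j t)) (at t within {0..}))"

text \<open>Arc length on the unit circle, as the image of Lebesgue measure under the
  parametrisation by the angle.\<close>

definition circle_point :: "real \<Rightarrow> real^2" where
  "circle_point \<theta> = vector [cos \<theta>, sin \<theta>]"

definition circle_measure :: "(real^2) measure" where
  "circle_measure =
     distr (restrict_space lborel {-pi<..pi}) (restrict_space borel (sphere 0 1)) circle_point"

lemma norm_circle_point: "norm (circle_point \<theta>) = 1"
  by (simp add: circle_point_def norm_vec_def L2_set_def sum_2)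

lemma continuous_circle_point: "continuous_on UNIV circle_point"
proof -
  have "continuous_on UNIV (\<lambda>\<theta>. \<chi> i. circle_point \<theta> $ i)"
  proof (rule continuous_on_vec_lambda)
    fix i :: 2
    show "continuous_on UNIV (\<lambda>\<theta>. circle_point \<theta> $ i)"
      using exhaust_2[of i]
      by (auto simp: circle_point_def continuous_on_cos continuous_on_sin)
  qed
  then show ?thesis by simp
qed

lemma measurable_circle_point:
  "circle_point \<in> restrict_space lborel {-pi<..pi} \<rightarrow>\<^sub>M restrict_space borel (sphere 0 1)"
proof (rule measurable_restrict_space2)
  show "circle_point \<in> borel_measurable (restrict_space lborel {-pi<..pi})"
    by (intro measurable_restrict_space1)
       (simp add: borel_measurable_continuous_onI continuous_circle_point)
qed (simp add: norm_circle_point)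

lemma space_circle_measure: "space circle_measure = sphere 0 1"
  by (simp add: circle_measure_def space_restrict_space)

lemma emeasure_circle_measure_total: "emeasure circle_measure (sphere 0 1) = ennreal (2 * pi)"
proof -
  have "emeasure circle_measure (space circle_measure) =
      emeasure (restrict_space lborel {-pi<..pi}) (space (restrict_space lborel {-pi<..pi}))"
    using emeasure_distr[OF measurable_circle_point sets.top]
      measurable_space[OF measurable_circle_point]
    by (simp add: circle_measure_def Int_absorb1 subset_iff)
  also have "\<dots> = ennreal (2 * pi)"
    by (simp add: space_restrict_space emeasure_restrict_space)
  finally show ?thesis by (simp add: space_circle_measure)
qed

end

theory Submission
  imports Defs
begin

text \<open>
  Each agent is a point on the unit circle pulled towards a moving vector \<open>f\<close>:
  \<open>b' = P\<^sub>b f\<close>, where \<open>f\<close> is the constant \<open>b\<^sub>1\<^sup>*\<close> for the root and depends only on agents of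
  smaller index for the others. So the system is a cascade. Write \<open>d\<^sub>i\<close> for the unit vector
  from \<open>p\<^sub>i\<close> to the feasible target. Once all predecessors of \<open>i\<close> converge to their \<open>d\<^sub>j\<close>,
  feasibility makes the vector driving agent \<open>i\<close> converge to \<open>k d\<^sub>i\<close> with \<open>k > 0\<close> (namely \<open>k = 1\<close> for
  the root and the in-degree otherwise), because every summand tends to the same \<open>d\<^sub>i\<close>.

  Two facts about a single agent whose driving vector tends to \<open>k d\<close> carry the argument.
  First, it converges to \<open>d\<close> or to \<open>- d\<close> (\<open>driven_dichotomy\<close>), because \<open>b \<bullet> d\<close> eventually has
  a derivative bounded below by a positive constant whenever it stays away from \<open>1\<close> and \<open>- 1\<close>.
  Second, at most one initial heading leads to \<open>- d\<close> (\<open>driven_antipodal_unique\<close>): for two solutions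
  \<open>b, c\<close> with the same driving vector, \<open>g = 1 - b \<bullet> c\<close> satisfies \<open>g' = - (f \<bullet> b + f \<bullet> c) g\<close>, and near
  \<open>- d\<close> the coefficient is positive, so that two such solutions separate instead of merging.

  Hence the initial conditions for which agent \<open>i\<close> is the first to fail form a set that meets each
  circle obtained by varying the \<open>i\<close>-th heading alone in at most one point, and Fubini shows that it is null
  (\<open>AE_PiM_not_in_if_slices_subsingleton\<close>), as soon as it is measurable. Measurability comes from
  the existence of a flow that is jointly continuous in the initial condition and time
  (\<open>flow_exists\<close>). In terms of the rotation angle, each agent obeys a scalar equation with a
  bounded and globally Lipschitz right-hand side, and Banach's fixed point theorem in a space of
  bounded continuous functions of both the initial condition and time yields solution and
  continuity at once (\<open>parametrised_ode_solution\<close>).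
\<close>

section \<open>Headings driven by a moving vector\<close>

definition driven :: "(real \<Rightarrow> real^2) \<Rightarrow> (real \<Rightarrow> real^2) \<Rightarrow> bool" where
  "driven f b \<longleftrightarrow> (\<forall>t\<ge>0. norm (b t) = 1 \<and>
     (b has_vector_derivative perp_proj (b t) *v f t) (at t within {0..}))"

lemma perp_proj_mult: "perp_proj b *v f = f - (b \<bullet> f) *\<^sub>R b"
proof -
  have "(\<chi> i j. b $ i * b $ j) *v f = (b \<bullet> f) *\<^sub>R b"
    by (simp add: vec_eq_iff matrix_vector_mult_def inner_vec_def sum_distrib_left ac_simps)
  then show ?thesis by (simp add: perp_proj_def matrix_vector_mult_diff_rdistrib)
qed

lemma driven_norm: "driven f b \<Longrightarrow> 0 \<le> t \<Longrightarrow> norm (b t) = 1"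
  by (simp add: driven_def)

lemma driven_vector_derivative:
  "driven f b \<Longrightarrow> 0 \<le> t \<Longrightarrow>
    (b has_vector_derivative f t - (b t \<bullet> f t) *\<^sub>R b t) (at t within {0..})"
  by (simp add: driven_def perp_proj_mult)

lemma driven_cong:
  assumes "driven f b" "\<And>t. 0 \<le> t \<Longrightarrow> f t = g t"
  shows "driven g b"
  using assms by (simp add: driven_def)

lemma inner_eq_one_iff:
  fixes b c :: "'a::real_inner"
  assumes "norm b = 1" "norm c = 1"
  shows "b \<bullet> c = 1 \<longleftrightarrow> b = c"
  using norm_cauchy_schwarz_eq[of b c] assms by auto

text \<open>The quantity \<open>1 - b \<bullet> c = \<bar>b - c\<bar>\<^sup>2 / 2\<close> measures the distance of two solutions with
  the same driving vector. It obeys a homogeneous linear equation, from which both uniqueness and the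
  repulsion from the antipode are read off.\<close>

lemma driven_inner_derivative:
  assumes "driven f b" "driven f c" "0 \<le> t"
  shows "((\<lambda>t. 1 - b t \<bullet> c t) has_real_derivative
            - (f t \<bullet> b t + f t \<bullet> c t) * (1 - b t \<bullet> c t)) (at t within {0..})"
proof -
  have "((\<lambda>t. b t \<bullet> c t) has_vector_derivative
          b t \<bullet> (f t - (c t \<bullet> f t) *\<^sub>R c t) + (f t - (b t \<bullet> f t) *\<^sub>R b t) \<bullet> c t) (at t within {0..})"
    by (rule bounded_bilinear.has_vector_derivative[OF bounded_bilinear_inner
          driven_vector_derivative[OF assms(1,3)] driven_vector_derivative[OF assms(2,3)]])
  then have "((\<lambda>t. b t \<bullet> c t) has_real_derivative
          b t \<bullet> (f t - (c t \<bullet> f t) *\<^sub>R c t) + (f t - (b t \<bullet> f t) *\<^sub>R b t) \<bullet> c t) (at t within {0..})"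
    by (simp add: has_real_derivative_iff_has_vector_derivative)
  from DERIV_diff[OF DERIV_const[of 1] this] show ?thesis
    by (simp add: inner_diff_left inner_diff_right inner_commute algebra_simps)
qed

text \<open>Derivatives within \<open>{0..}\<close> are one-sided at \<open>0\<close>, so the usual monotonicity criterion is
  applied on the open interval and completed by continuity.\<close>

lemma half_line_mono:
  fixes h :: "real \<Rightarrow> real"
  assumes "0 \<le> a" "a \<le> b"
    and der: "\<And>t. 0 \<le> t \<Longrightarrow> (h has_real_derivative h' t) (at t within {0..})"
    and nn: "\<And>t. a < t \<Longrightarrow> t < b \<Longrightarrow> 0 \<le> h' t"
  shows "h a \<le> h b"
proof (rule DERIV_nonneg_imp_increasing_open[OF \<open>a \<le> b\<close>])
  fix t assume t: "a < t" "t < b"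
  have "at t within {0..} = at t"
    using t assms(1) by (intro at_within_interior) simp
  then show "\<exists>y. DERIV h t :> y \<and> 0 \<le> y"
    using der[of t] nn t assms(1) by auto
next
  have "continuous_on {0..} h"
    using der by (auto intro!: DERIV_continuous_on)
  then show "continuous_on {a..b} h"
    by (rule continuous_on_subset) (use assms(1) in auto)
qed

text \<open>Gronwall in both time directions: as \<open>\<bar>g'\<bar> \<le> 2 K g\<close>, the function \<open>exp (- 2 K t) g t\<close> decreases
  and \<open>exp (2 K t) g t\<close> increases, so a zero of \<open>g\<close> spreads to all later and all earlier times. The
  backward direction is what turns eventual coincidence into equality of initial headings.\<close>

lemma driven_unique:
  assumes b: "driven f b" and c: "driven f c" and K: "\<And>t. 0 \<le> t \<Longrightarrow> norm (f t) \<le> K"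
    and eq: "b s = c s" and s: "0 \<le> s" and t: "0 \<le> t"
  shows "b t = c t"
proof -
  define g where "g = (\<lambda>t. 1 - b t \<bullet> c t)"
  define k where "k = (\<lambda>t. - (f t \<bullet> b t + f t \<bullet> c t))"
  have der: "(g has_real_derivative k t * g t) (at t within {0..})" if "0 \<le> t" for t
    unfolding g_def k_def by (rule driven_inner_derivative[OF b c that])
  have K': "\<bar>k t\<bar> \<le> 2 * K" if "0 \<le> t" for t
  proof -
    have "\<bar>f t \<bullet> b t\<bar> \<le> K" "\<bar>f t \<bullet> c t\<bar> \<le> K"
      using Cauchy_Schwarz_ineq2[of "f t" "b t"] Cauchy_Schwarz_ineq2[of "f t" "c t"]
        K[OF that] driven_norm[OF b that] driven_norm[OF c that] by auto
    then show ?thesis by (simp add: k_def)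
  qed
  have g0: "0 \<le> g t" if "0 \<le> t" for t
    using norm_cauchy_schwarz[of "b t" "c t"] driven_norm[OF b that] driven_norm[OF c that]
    by (simp add: g_def)
  have gs: "g s = 0"
    using driven_norm[OF c s] by (simp add: g_def eq norm_eq_1)
  have "g t \<le> 0"
  proof (cases "s \<le> t")
    case True
    have "- (exp (- 2 * K * s) * g s) \<le> - (exp (- 2 * K * t) * g t)"
    proof (rule half_line_mono[OF s True])
      fix u :: real assume u: "0 \<le> u"
      show "((\<lambda>u. - (exp (- 2 * K * u) * g u)) has_real_derivative
               (2 * K - k u) * (exp (- 2 * K * u) * g u)) (at u within {0..})"
        by (rule derivative_eq_intros der[OF u] refl)+ (simp add: algebra_simps)
    next
      fix u assume "s < u"
      then have "0 \<le> u" using s by simp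
      with K'[OF this] g0[OF this]
      show "0 \<le> (2 * K - k u) * (exp (- 2 * K * u) * g u)"
        by (intro mult_nonneg_nonneg) auto
    qed
    then show ?thesis by (simp add: gs mult_le_0_iff)
  next
    case False
    then have ts: "t \<le> s" by simp
    have "exp (2 * K * t) * g t \<le> exp (2 * K * s) * g s"
    proof (rule half_line_mono[OF t ts])
      fix u :: real assume u: "0 \<le> u"
      show "((\<lambda>u. exp (2 * K * u) * g u) has_real_derivative
               (2 * K + k u) * (exp (2 * K * u) * g u)) (at u within {0..})"
        by (rule derivative_eq_intros der[OF u] refl)+ (simp add: algebra_simps)
    next
      fix u assume "t < u"
      then have "0 \<le> u" using t by simp
      with K'[OF this] g0[OF this]
      show "0 \<le> (2 * K + k u) * (exp (2 * K * u) * g u)"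
        by (intro mult_nonneg_nonneg) auto
    qed
    then show ?thesis by (simp add: gs mult_le_0_iff)
  qed
  with g0[OF t] have "b t \<bullet> c t = 1" by (simp add: g_def)
  then show ?thesis
    using inner_eq_one_iff driven_norm[OF b t] driven_norm[OF c t] by blast
qed

text \<open>The antipode of the limiting direction repels. When both solutions are close to \<open>- d\<close>, their
  distance \<open>g\<close> is nondecreasing; as it also tends to \<open>0\<close>, it vanishes from some time on.\<close>

lemma driven_antipodal_unique:
  assumes b: "driven f b" and c: "driven f c" and K: "\<And>t. 0 \<le> t \<Longrightarrow> norm (f t) \<le> K"
    and f: "(f \<longlongrightarrow> k *\<^sub>R d) at_top" and k: "0 < k" and d: "norm d = 1"
    and bd: "(b \<longlongrightarrow> - d) at_top" and cd: "(c \<longlongrightarrow> - d) at_top"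
  shows "b 0 = c 0"
proof -
  define g where "g = (\<lambda>t. 1 - b t \<bullet> c t)"
  have dd: "d \<bullet> d = 1" using d by (simp add: norm_eq_1)
  have "((\<lambda>t. f t \<bullet> b t + f t \<bullet> c t) \<longlongrightarrow> (k *\<^sub>R d) \<bullet> (- d) + (k *\<^sub>R d) \<bullet> (- d)) at_top"
    by (intro tendsto_intros f bd cd)
  then have "\<forall>\<^sub>F t in at_top. f t \<bullet> b t + f t \<bullet> c t < 0"
    by (rule order_tendstoD) (use k dd in simp)
  then obtain T0 where T0: "\<And>t. T0 \<le> t \<Longrightarrow> f t \<bullet> b t + f t \<bullet> c t < 0"
    by (auto simp: eventually_at_top_linorder)
  define T where "T = max 0 T0"
  have T: "0 \<le> T" "T0 \<le> T" by (auto simp: T_def)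
  have g0: "0 \<le> g t" if "0 \<le> t" for t
    using norm_cauchy_schwarz[of "b t" "c t"] driven_norm[OF b that] driven_norm[OF c that]
    by (simp add: g_def)
  have mono: "g T \<le> g t" if "T \<le> t" for t
  proof (rule half_line_mono[OF T(1) that])
    fix u :: real assume u: "0 \<le> u"
    show "(g has_real_derivative - (f u \<bullet> b u + f u \<bullet> c u) * g u) (at u within {0..})"
      unfolding g_def by (rule driven_inner_derivative[OF b c u])
  next
    fix u assume "T < u"
    then have "0 \<le> u" "T0 \<le> u" using T by auto
    with T0[of u] g0[of u] show "0 \<le> - (f u \<bullet> b u + f u \<bullet> c u) * g u"
      by (intro mult_nonneg_nonneg) auto
  qed
  have "(g \<longlongrightarrow> 1 - (- d) \<bullet> (- d)) at_top"
    unfolding g_def by (intro tendsto_intros bd cd)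
  then have "(g \<longlongrightarrow> 0) at_top" using dd by simp
  then have "g T \<le> 0"
    by (rule tendsto_lowerbound)
       (use mono in \<open>auto simp: eventually_at_top_linorder\<close>)
  with g0[OF T(1)] have "b T \<bullet> c T = 1" by (simp add: g_def)
  then have "b T = c T"
    using inner_eq_one_iff driven_norm[OF b T(1)] driven_norm[OF c T(1)] by blast
  from driven_unique[OF b c K this T(1)] show ?thesis by simp
qed

section \<open>Convergence to the limiting direction or its antipode\<close>

text \<open>At the last time at which \<open>h \<ge> s\<close>, one has \<open>h = s\<close>, and a positive derivative there pushes
  \<open>h\<close> above \<open>s\<close> again.\<close>

lemma threshold_not_recrossed:
  fixes h :: "real \<Rightarrow> real"
  assumes der: "\<And>t. 0 \<le> t \<Longrightarrow> (h has_real_derivative h' t) (at t within {0..})"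
    and pos: "\<And>t. T \<le> t \<Longrightarrow> h t = s \<Longrightarrow> 0 < h' t"
    and t: "0 \<le> T" "T \<le> t0" "t0 \<le> t1" and start: "s \<le> h t0"
  shows "s \<le> h t1"
proof (rule ccontr)
  assume "\<not> s \<le> h t1"
  then have below: "h t1 < s" by simp
  have "continuous_on {0..} h"
    using der by (auto intro!: DERIV_continuous_on)
  then have cont: "continuous_on {u..t1} h" if "0 \<le> u" for u
    by (rule continuous_on_subset) (use that in auto)
  have "closed ({t0..t1} \<inter> h -` {s..})"
    using cont t by (intro continuous_closed_preimage) auto
  then have "compact ({t0..t1} \<inter> h -` {s..})"
    by (meson bounded_Int bounded_closed_interval compact_eq_bounded_closed)
  moreover have "t0 \<in> {t0..t1} \<inter> h -` {s..}" using t start by auto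
  ultimately obtain \<tau> where \<tau>: "t0 \<le> \<tau>" "\<tau> \<le> t1" "s \<le> h \<tau>"
    and last: "\<And>u. t0 \<le> u \<Longrightarrow> u \<le> t1 \<Longrightarrow> s \<le> h u \<Longrightarrow> u \<le> \<tau>"
    using compact_attains_sup[of "{t0..t1} \<inter> h -` {s..}"] by force
  have \<tau>0: "0 \<le> \<tau>" "T \<le> \<tau>" using \<tau> t by auto
  obtain u where u: "\<tau> \<le> u" "u \<le> t1" "h u = s"
    using IVT2'[of h t1 s \<tau>] below \<tau> cont[OF \<tau>0(1)] by auto
  have "u = \<tau>" using last[of u] u \<tau> by auto
  then have eq: "h \<tau> = s" using u by simp
  obtain e where e: "0 < e" "\<And>x. 0 < x \<Longrightarrow> \<tau> + x \<in> {0..} \<Longrightarrow> x < e \<Longrightarrow> h \<tau> < h (\<tau> + x)"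
    using has_real_derivative_pos_inc_right[OF der[OF \<tau>0(1)] pos[OF \<tau>0(2) eq]] by blast
  have "\<tau> < t1" using below eq \<tau> by (cases "\<tau> = t1") auto
  define x where "x = min (e / 2) (t1 - \<tau>)"
  have x: "0 < x" "x < e" "\<tau> + x \<le> t1" using \<open>\<tau> < t1\<close> e by (auto simp: x_def)
  with e(2)[of x] \<tau>0 eq have "s < h (\<tau> + x)" by auto
  with last[of "\<tau> + x"] x \<tau> show False by auto
qed

text \<open>Inside the band \<open>[- r, r]\<close> the function grows at rate at least \<open>\<kappa>\<close>, so it can leave the band
  only through the top, does so in finite time, and never falls back.\<close>

lemma crosses_band_upwards:
  fixes h :: "real \<Rightarrow> real"
  assumes der: "\<And>t. 0 \<le> t \<Longrightarrow> (h has_real_derivative h' t) (at t within {0..})"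
    and pos: "\<And>t. T \<le> t \<Longrightarrow> \<bar>h t\<bar> \<le> r \<Longrightarrow> \<kappa> \<le> h' t"
    and \<kappa>: "0 < \<kappa>" and r: "0 \<le> r" and T: "0 \<le> T" and start: "- r \<le> h T"
  shows "\<forall>\<^sub>F t in at_top. r \<le> h t"
proof -
  have low: "- r \<le> h t" if "T \<le> t" for t
    by (rule threshold_not_recrossed[OF der, where T=T and ?t0.0=T])
       (use pos \<kappa> r T start that in \<open>auto intro: less_le_trans\<close>)
  have "\<exists>t\<ge>T. r \<le> h t"
  proof (rule ccontr)
    assume "\<not> ?thesis"
    then have up: "h t < r" if "T \<le> t" for t using that by auto
    \<comment> \<open>Growing at rate \<open>\<kappa>\<close> for this long raises \<open>h\<close> by \<open>2 r + 1\<close>, more than the width of the band.\<close>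
    define t where "t = T + (2 * r + 1) / \<kappa>"
    have "T \<le> t" using \<kappa> r by (simp add: t_def)
    have "h T - \<kappa> * T \<le> h t - \<kappa> * t"
    proof (rule half_line_mono[OF T \<open>T \<le> t\<close>])
      fix u :: real assume u: "0 \<le> u"
      show "((\<lambda>u. h u - \<kappa> * u) has_real_derivative h' u - \<kappa>) (at u within {0..})"
        by (rule derivative_eq_intros der[OF u] refl)+ simp
    next
      fix u assume "T < u"
      then show "0 \<le> h' u - \<kappa>" using pos[of u] low[of u] up[of u] by auto
    qed
    then have "h T + \<kappa> * (t - T) \<le> h t" by (simp add: algebra_simps)
    moreover have "\<kappa> * (t - T) = 2 * r + 1" using \<kappa> by (simp add: t_def)
    ultimately show False using start up[OF \<open>T \<le> t\<close>] by simp
  qed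
  then obtain t1 where t1: "T \<le> t1" "r \<le> h t1" by blast
  have "r \<le> h t" if "t1 \<le> t" for t
    by (rule threshold_not_recrossed[OF der, where T=T and ?t0.0=t1])
       (use pos \<kappa> r T t1 that in \<open>auto intro: less_le_trans\<close>)
  then show ?thesis by (auto simp: eventually_at_top_linorder)
qed

lemma tendsto_of_inner_tendsto_one:
  fixes b :: "real \<Rightarrow> real^2"
  assumes lim: "((\<lambda>t. b t \<bullet> d) \<longlongrightarrow> 1) at_top" and d: "norm d = 1"
    and nb: "\<And>t. 0 \<le> t \<Longrightarrow> norm (b t) = 1"
  shows "(b \<longlongrightarrow> d) at_top"
proof -
  have eq: "norm (b t - d) = sqrt (2 - 2 * (b t \<bullet> d))" if "0 \<le> t" for t
    using nb[OF that] d
    by (simp add: norm_eq_sqrt_inner inner_diff_left inner_diff_right inner_commute)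
  have "((\<lambda>t. sqrt (2 - 2 * (b t \<bullet> d))) \<longlongrightarrow> sqrt (2 - 2 * 1)) at_top"
    by (intro tendsto_intros lim)
  then have "((\<lambda>t. norm (b t - d)) \<longlongrightarrow> sqrt (2 - 2 * 1)) at_top"
    by (rule Lim_transform_eventually)
       (use eq in \<open>auto simp: eventually_at_top_linorder intro!: exI[of _ 0]\<close>)
  then show ?thesis by (simp add: tendsto_norm_zero_iff LIM_zero_iff)
qed

text \<open>With \<open>h = b \<bullet> d\<close> and \<open>e = f - k d \<rightarrow> 0\<close> one gets \<open>h' \<ge> k (1 - h\<^sup>2) - 2 \<bar>e\<bar>\<close>. If \<open>h\<close> does not tend
  to \<open>- 1\<close>, it exceeds, at arbitrarily late times, some \<open>- r\<close> with \<open>r < 1\<close>, and \<open>crosses_band_upwards\<close> lifts it above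
  \<open>r\<close> for good. The same holds for every larger \<open>r < 1\<close>, hence \<open>h \<rightarrow> 1\<close>.\<close>

lemma driven_dichotomy:
  assumes b: "driven f b" and f: "(f \<longlongrightarrow> k *\<^sub>R d) at_top" and k: "0 < k" and d: "norm d = 1"
  shows "(b \<longlongrightarrow> d) at_top \<or> (b \<longlongrightarrow> - d) at_top"
proof -
  define h where "h = (\<lambda>t. b t \<bullet> d)"
  define h' where "h' = (\<lambda>t. f t \<bullet> d - (b t \<bullet> f t) * h t)"
  have der: "(h has_real_derivative h' t) (at t within {0..})" if "0 \<le> t" for t
  proof -
    have "(h has_vector_derivative (f t - (b t \<bullet> f t) *\<^sub>R b t) \<bullet> d) (at t within {0..})"
      unfolding h_def
      by (rule bounded_linear.has_vector_derivative[OF bounded_linear_inner_left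
            driven_vector_derivative[OF b that]])
    then show ?thesis
      by (simp add: has_real_derivative_iff_has_vector_derivative h'_def h_def inner_diff_left)
  qed
  have dd: "d \<bullet> d = 1" using d by (simp add: norm_eq_1)
  have h1: "\<bar>h t\<bar> \<le> 1" if "0 \<le> t" for t
    using Cauchy_Schwarz_ineq2[of "b t" d] driven_norm[OF b that] d by (simp add: h_def)
  have low: "k * (1 - (h t)\<^sup>2) - 2 * norm (f t - k *\<^sub>R d) \<le> h' t" if "0 \<le> t" for t
  proof -
    define e where "e = f t - k *\<^sub>R d"
    have "f t = k *\<^sub>R d + e" by (simp add: e_def)
    then have "h' t = k * (1 - (h t)\<^sup>2) + (e \<bullet> d - (b t \<bullet> e) * h t)"
      by (simp add: h'_def h_def inner_add_left inner_add_right dd power2_eq_square algebra_simps)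
    moreover have "\<bar>e \<bullet> d\<bar> \<le> norm e" "\<bar>b t \<bullet> e\<bar> \<le> norm e"
      using Cauchy_Schwarz_ineq2[of e d] Cauchy_Schwarz_ineq2[of "b t" e]
        driven_norm[OF b that] d by auto
    moreover have "\<bar>(b t \<bullet> e) * h t\<bar> \<le> norm e * 1"
      unfolding abs_mult using calculation(3) h1[OF that] by (intro mult_mono) auto
    ultimately show ?thesis unfolding e_def[symmetric] by (simp only: abs_le_iff) linarith
  qed
  have cross: "\<forall>\<^sub>F t in at_top. r \<le> h t"
    if r: "0 \<le> r" "r < 1" and freq: "\<exists>\<^sub>F t in at_top. - r \<le> h t" for r
  proof -
    \<comment> \<open>Half of the minimum of \<open>k (1 - h\<^sup>2)\<close> on the band; the perturbation takes the other half.\<close>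
    define \<kappa> where "\<kappa> = k * (1 - r\<^sup>2) / 2"
    have "r\<^sup>2 < 1" using r by (simp add: power_less_one_iff abs_square_less_1)
    then have \<kappa>: "0 < \<kappa>" using k by (simp add: \<kappa>_def)
    have "((\<lambda>t. norm (f t - k *\<^sub>R d)) \<longlongrightarrow> 0) at_top"
      using f by (simp add: tendsto_norm_zero_iff LIM_zero_iff)
    then have "\<forall>\<^sub>F t in at_top. norm (f t - k *\<^sub>R d) < \<kappa> / 2"
      by (rule order_tendstoD) (use \<kappa> in simp)
    then obtain T0 where T0: "\<And>t. T0 \<le> t \<Longrightarrow> norm (f t - k *\<^sub>R d) < \<kappa> / 2"
      by (auto simp: eventually_at_top_linorder)
    from freq obtain T where T: "max 0 T0 \<le> T" "- r \<le> h T"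
      using eventually_ge_at_top[of "max 0 T0"]
      by (metis (mono_tags, lifting) frequently_eventually_frequently frequently_ex)
    show ?thesis
    proof (rule crosses_band_upwards[OF der _ \<kappa> r(1), where T=T])
      fix t assume t: "T \<le> t" "\<bar>h t\<bar> \<le> r"
      then have "(h t)\<^sup>2 \<le> r\<^sup>2" by (metis abs_ge_zero power2_abs power_mono)
      then have "k * (1 - r\<^sup>2) \<le> k * (1 - (h t)\<^sup>2)" using k by simp
      with low[of t] T0[of t] t T show "\<kappa> \<le> h' t" by (simp add: \<kappa>_def)
    qed (use T in auto)
  qed
  show ?thesis
  proof (cases "(h \<longlongrightarrow> - 1) at_top")
    case True
    then have "((\<lambda>t. b t \<bullet> (- d)) \<longlongrightarrow> 1) at_top"
      using tendsto_minus[OF True] by (simp add: h_def)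
    then have "(b \<longlongrightarrow> - d) at_top"
      by (rule tendsto_of_inner_tendsto_one) (use d driven_norm[OF b] in auto)
    then show ?thesis ..
  next
    case False
    have "\<exists>r0<1. \<exists>\<^sub>F t in at_top. - r0 \<le> h t"
    proof (rule ccontr)
      assume "\<not> ?thesis"
      then have ev: "\<forall>\<^sub>F t in at_top. h t < - r" if "r < 1" for r
        using that by (auto simp: not_frequently not_le)
      have "(h \<longlongrightarrow> - 1) at_top"
      proof (rule order_tendstoI)
        fix a :: real assume "a < - 1"
        show "\<forall>\<^sub>F t in at_top. a < h t"
          using eventually_ge_at_top[of 0]
          by eventually_elim (use h1 \<open>a < - 1\<close> in \<open>fastforce simp: abs_le_iff\<close>)
      next
        fix a :: real assume "- 1 < a"
        then show "\<forall>\<^sub>F t in at_top. h t < a" using ev[of "- a"] by simp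
      qed
      with False show False ..
    qed
    then obtain r0 where r0: "r0 < 1" "\<exists>\<^sub>F t in at_top. - r0 \<le> h t" by blast
    have "(h \<longlongrightarrow> 1) at_top"
    proof (rule order_tendstoI)
      fix a :: real assume "a < 1"
      define r where "r = (1 + max 0 (max a r0)) / 2"
      have r: "0 \<le> r" "r < 1" "a < r" "r0 < r" using \<open>a < 1\<close> r0(1) by (auto simp: r_def)
      have "\<exists>\<^sub>F t in at_top. - r \<le> h t"
        using r0(2) by (rule frequently_elim1) (use r in auto)
      from cross[OF r(1,2) this] show "\<forall>\<^sub>F t in at_top. a < h t"
        by eventually_elim (use r in auto)
    next
      fix a :: real assume "1 < a"
      show "\<forall>\<^sub>F t in at_top. h t < a"
        using eventually_ge_at_top[of 0]
        by eventually_elim (use h1 \<open>1 < a\<close> in \<open>fastforce simp: abs_le_iff\<close>)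
    qed
    then have "(b \<longlongrightarrow> d) at_top"
      unfolding h_def by (rule tendsto_of_inner_tendsto_one) (use d driven_norm[OF b] in auto)
    then show ?thesis ..
  qed
qed

section \<open>Scalar differential equations with a parameter\<close>

text \<open>Fixing the domain of integration makes theorems on integrals with a parameter applicable to
  integrals with a variable upper limit.\<close>

lemma integral_rescale_to_unit:
  fixes h :: "real \<Rightarrow> real"
  assumes "continuous_on UNIV h" "0 \<le> m"
  shows "integral {0..m} h = m * integral {0..1} (\<lambda>s. h (m * s))"
proof -
  have "((\<lambda>s. m *\<^sub>R h (m * s)) has_integral integral {m * 0..m * 1} h) {0..1}"
  proof (rule has_integral_substitution[where c=0 and d=m])
    show "(*) m ` {0..1} \<subseteq> {0..m}"
      using assms(2) by (auto simp: mult_left_le)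
  qed (use assms in \<open>auto intro!: derivative_eq_intros continuous_on_subset[OF assms(1)]\<close>)
  then have "integral {0..1} (\<lambda>s. m * h (m * s)) = integral {0..m} h"
    by (simp add: has_integral_iff)
  then show ?thesis by simp
qed

lemma continuous_indefinite_integral_param:
  fixes h :: "'x::topological_space \<Rightarrow> real \<Rightarrow> real"
  assumes h: "continuous_on UNIV (\<lambda>(x, s). h x s)"
  shows "continuous_on UNIV (\<lambda>(x, t). integral {0..max 0 t} (h x))"
proof -
  have hx: "continuous_on UNIV (h x)" for x
    using continuous_on_compose2[OF h, of UNIV "\<lambda>s. (x, s)"] by (simp add: continuous_intros)
  have "continuous_on (UNIV \<times> cbox 0 1) (\<lambda>(z, s). h (fst z) (max 0 (snd z) * s))"
    unfolding split_beta
    by (rule continuous_on_compose2[OF h, of _ "\<lambda>w. (fst (fst w), max 0 (snd (fst w)) * snd w)",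
          simplified]) (intro continuous_intros)
  then have "continuous_on UNIV (\<lambda>z. integral (cbox 0 1) (\<lambda>s. h (fst z) (max 0 (snd z) * s)))"
    by (rule integral_continuous_on_param)
  then have "continuous_on UNIV (\<lambda>z. max 0 (snd z) *
      integral (cbox 0 1) (\<lambda>s. h (fst z) (max 0 (snd z) * s)))"
    by (intro continuous_intros)
  then show ?thesis
    by (simp add: split_beta integral_rescale_to_unit[OF hx])
qed

text \<open>The unknown is the weighted function \<open>v (x, t) = exp (- 2 K t) u x t\<close>. In this weight the
  integral operator is a contraction with factor \<open>1/2\<close> for all times simultaneously, and it maps into
  bounded functions because \<open>u\<close> grows at most linearly. Working with functions of \<open>x\<close> and \<open>t\<close>
  together makes joint continuity part of the fixed point space. Negative times are mapped to \<open>0\<close>, which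
  gives a continuous function on the whole line without restricting the domain.\<close>

lemma parametrised_ode_solution:
  fixes g :: "'x::metric_space \<Rightarrow> real \<Rightarrow> real \<Rightarrow> real"
  assumes g: "continuous_on UNIV (\<lambda>(x, t, u). g x t u)"
    and K: "0 < K" and bd: "\<And>x t u. \<bar>g x t u\<bar> \<le> K"
    and lip: "\<And>x t u v. \<bar>g x t u - g x t v\<bar> \<le> K * \<bar>u - v\<bar>"
  obtains u where "continuous_on UNIV (\<lambda>(x, t). u x t)" "\<And>x. u x 0 = 0"
    "\<And>x t. 0 \<le> t \<Longrightarrow> (u x has_real_derivative g x t (u x t)) (at t within {0..})"
proof -
  define h where "h = (\<lambda>(v :: ('x \<times> real) \<Rightarrow>\<^sub>C real) x s. g x s (exp (2 * K * s) * apply_bcontfun v (x, s)))"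
  define \<Phi> where "\<Phi> = (\<lambda>v (x, t). exp (- 2 * K * max 0 t) * integral {0..max 0 t} (h v x))"
  have hc: "continuous_on UNIV (\<lambda>(x, s). h v x s)" for v
  proof -
    have "continuous_on UNIV (\<lambda>z::'x \<times> real.
            (fst z, snd z, exp (2 * K * snd z) * apply_bcontfun v (fst z, snd z)))"
      by (intro continuous_intros continuous_on_compose2[OF continuous_on_apply_bcontfun[of UNIV v]]) auto
    from continuous_on_compose2[OF g this] show ?thesis
      by (simp add: h_def split_beta)
  qed
  have hx: "continuous_on S (h v x)" for v x S
    using continuous_on_compose2[OF hc, of S "\<lambda>s. (x, s)"] by (simp add: continuous_intros)
  have hi: "h v x integrable_on {0..m}" for v x m
    by (rule integrable_continuous_real[OF hx])
  have wexp: "exp (- 2 * K * m) * (K * m) \<le> 1" if "0 \<le> m" for m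
  proof -
    have "0 \<le> K * m" using K that by simp
    then have "K * m \<le> 1 + 2 * K * m" by simp
    also have "\<dots> \<le> exp (2 * K * m)" by (rule exp_ge_add_one_self)
    finally have "K * m \<le> exp (2 * K * m)" .
    then have "exp (- 2 * K * m) * (K * m) \<le> exp (- 2 * K * m) * exp (2 * K * m)"
      by (intro mult_left_mono) auto
    then show ?thesis by (simp add: exp_minus)
  qed
  have \<Phi>: "\<Phi> v \<in> bcontfun" for v
  proof (rule bcontfun_normI)
    have "continuous_on UNIV (\<lambda>z::'x \<times> real. exp (- 2 * K * max 0 (snd z)) *
            (\<lambda>(x, t). integral {0..max 0 t} (h v x)) z)"
      by (rule continuous_on_mult[OF _ continuous_indefinite_integral_param[OF hc]])
         (intro continuous_intros)
    then show "continuous_on UNIV (\<Phi> v)"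
      by (simp add: \<Phi>_def split_beta)
    fix z :: "'x \<times> real"
    obtain x t where z: "z = (x, t)" by fastforce
    define m where "m = max 0 t"
    have m: "0 \<le> m" by (simp add: m_def)
    have "norm (integral {0..m} (h v x)) \<le> K * (m - 0)"
      by (rule integral_bound[OF m hx]) (simp add: h_def bd)
    then have "norm (\<Phi> v z) \<le> exp (- 2 * K * m) * (K * m)"
      by (simp add: \<Phi>_def z m_def[symmetric] abs_mult)
    with wexp[OF m] show "norm (\<Phi> v z) \<le> 1" by simp
  qed
  have "dist (Bcontfun (\<Phi> v)) (Bcontfun (\<Phi> w)) \<le> 1 / 2 * dist v w" for v w
  proof (rule dist_bound)
    fix z :: "'x \<times> real"
    obtain x t where z: "z = (x, t)" by fastforce
    define m where "m = max 0 t"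
    have m: "0 \<le> m" by (simp add: m_def)
    define D where "D = dist v w"
    \<comment> \<open>The contraction estimate: \<open>K D\<close> times the integral of \<open>exp (2 K s)\<close> is at most \<open>exp (2 K m) D / 2\<close>.\<close>
    have "((\<lambda>s. K * (exp (2 * K * s) * D)) has_integral
            exp (2 * K * m) * D / 2 - exp (2 * K * 0) * D / 2) {0..m}"
    proof (rule fundamental_theorem_of_calculus[OF m])
      fix s assume "s \<in> {0..m}"
      have "((\<lambda>s. exp (2 * K * s) * D / 2) has_real_derivative K * (exp (2 * K * s) * D))
              (at s within {0..m})"
        by (rule derivative_eq_intros refl)+ (simp_all add: field_simps)
      then show "((\<lambda>s. exp (2 * K * s) * D / 2) has_vector_derivative K * (exp (2 * K * s) * D))
              (at s within {0..m})"
        by (simp add: has_real_derivative_iff_has_vector_derivative)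
    qed
    note I = this
    have "norm (integral {0..m} (\<lambda>s. h v x s - h w x s)) \<le> integral {0..m} (\<lambda>s. K * (exp (2 * K * s) * D))"
    proof (rule integral_norm_bound_integral)
      show "(\<lambda>s. h v x s - h w x s) integrable_on {0..m}"
        by (intro integrable_diff hi)
      show "(\<lambda>s. K * (exp (2 * K * s) * D)) integrable_on {0..m}" using I by blast
      fix s
      have "\<bar>h v x s - h w x s\<bar> \<le> K * \<bar>exp (2 * K * s) * apply_bcontfun v (x, s) - exp (2 * K * s) * apply_bcontfun w (x, s)\<bar>"
        unfolding h_def by (rule lip)
      also have "\<dots> = K * (exp (2 * K * s) * dist (apply_bcontfun v (x, s)) (apply_bcontfun w (x, s)))"
        by (simp add: dist_real_def abs_mult right_diff_distrib[symmetric])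
      also have "\<dots> \<le> K * (exp (2 * K * s) * D)"
        using K dist_bounded[of v "(x, s)" w] by (simp add: D_def)
      finally show "norm (h v x s - h w x s) \<le> K * (exp (2 * K * s) * D)" by simp
    qed
    also have "\<dots> \<le> exp (2 * K * m) * (D / 2)"
      using I by (simp add: has_integral_iff D_def)
    finally have "exp (- 2 * K * m) * norm (integral {0..m} (\<lambda>s. h v x s - h w x s))
        \<le> exp (- 2 * K * m) * (exp (2 * K * m) * (D / 2))"
      by (intro mult_left_mono) auto
    also have "\<dots> = D / 2" by (simp add: exp_minus)
    finally have "dist (\<Phi> v z) (\<Phi> w z) \<le> D / 2"
      by (simp add: \<Phi>_def z m_def[symmetric] dist_real_def integral_diff[OF hi hi]
          right_diff_distrib[symmetric] abs_mult)
    then show "dist (apply_bcontfun (Bcontfun (\<Phi> v)) z) (apply_bcontfun (Bcontfun (\<Phi> w)) z)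
        \<le> 1 / 2 * dist v w"
      by (simp add: Bcontfun_inverse[OF \<Phi>] D_def)
  qed
  then have "\<exists>!v. Bcontfun (\<Phi> v) = v"
    by (intro banach_fix_type[of "1 / 2"]) auto
  then obtain v where v: "Bcontfun (\<Phi> v) = v" by blast
  have fix_v: "apply_bcontfun v = \<Phi> v" using Bcontfun_inverse[OF \<Phi>, of v] by (simp add: v)
  define u where "u = (\<lambda>x t. integral {0..max 0 t} (h v x))"
  have uv: "u x t = exp (2 * K * t) * apply_bcontfun v (x, t)" if "0 \<le> t" for x t
    using that by (simp add: fix_v \<Phi>_def u_def exp_minus)
  show thesis
  proof
    show "continuous_on UNIV (\<lambda>(x, t). u x t)"
      unfolding u_def by (rule continuous_indefinite_integral_param[OF hc])
    show "u x 0 = 0" for x by (simp add: u_def)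
    fix x and t :: real assume t: "0 \<le> t"
    have "((\<lambda>t. integral {0..t} (h v x)) has_real_derivative h v x t) (at t within {0..t + 1})"
      by (rule integral_has_real_derivative[OF hx]) (use t in auto)
    moreover have "at t within {0..t + 1} = at t within {0..}"
      by (rule at_within_nhd[of t "{..<t + 1}"]) auto
    ultimately have "((\<lambda>t. integral {0..t} (h v x)) has_real_derivative h v x t) (at t within {0..})"
      by simp
    then have "(u x has_real_derivative h v x t) (at t within {0..})"
      by (rule has_field_derivative_transform_within[of _ _ _ _ 1]) (use t in \<open>auto simp: u_def\<close>)
    then show "(u x has_real_derivative g x t (u x t)) (at t within {0..})"
      by (simp add: h_def uv[OF t])
  qed
qed

section \<open>The flow of a driven heading\<close>

text \<open>The tangent direction at a point of the unit circle is its quarter turn, so the velocity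
  \<open>P\<^sub>b f\<close> is \<open>f \<bullet> J b\<close> times \<open>J b\<close>, with \<open>J\<close> the quarter turn (\<open>planar_projection\<close>). This replaces
  the equation for the heading by one for the rotation angle.\<close>

definition quarter_turn :: "real^2 \<Rightarrow> real^2" where
  "quarter_turn z = vector [- (z $ 2), z $ 1]"

lemma bounded_linear_quarter_turn: "bounded_linear quarter_turn"
  by (intro linear_conv_bounded_linear[THEN iffD1] linearI)
     (simp_all add: quarter_turn_def vec_eq_iff forall_2)

lemma inner_quarter_turn: "quarter_turn v \<bullet> quarter_turn w = v \<bullet> w"
  by (simp add: quarter_turn_def inner_vec_def sum_2)

lemma orthogonal_quarter_turn: "z \<bullet> quarter_turn z = 0"
  by (simp add: quarter_turn_def inner_vec_def sum_2)

lemma norm_quarter_turn: "norm (quarter_turn z) = norm z"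
  by (simp add: norm_eq_sqrt_inner inner_quarter_turn)

lemma quarter_turn_quarter_turn: "quarter_turn (quarter_turn z) = - z"
  by (simp add: quarter_turn_def vec_eq_iff forall_2)

lemma planar_projection:
  assumes "norm b = 1"
  shows "f - (b \<bullet> f) *\<^sub>R b = (f \<bullet> quarter_turn b) *\<^sub>R quarter_turn b"
proof -
  have "(b $ 1)\<^sup>2 + (b $ 2)\<^sup>2 = 1"
    using assms by (simp add: norm_eq_1 inner_vec_def sum_2 power2_eq_square)
  then have "f $ 1 = f $ 1 * ((b $ 1)\<^sup>2 + (b $ 2)\<^sup>2)" "f $ 2 = f $ 2 * ((b $ 1)\<^sup>2 + (b $ 2)\<^sup>2)"
    by simp_all
  then show ?thesis
    by (simp add: vec_eq_iff forall_2 quarter_turn_def inner_vec_def sum_2 power2_eq_square algebra_simps)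
qed

definition turn :: "real \<Rightarrow> real^2 \<Rightarrow> real^2" where
  "turn \<theta> z = cos \<theta> *\<^sub>R z + sin \<theta> *\<^sub>R quarter_turn z"

lemma norm_turn: "norm (turn \<theta> z) = norm z"
proof -
  have "turn \<theta> z \<bullet> turn \<theta> z = cos \<theta> * (cos \<theta> * (z \<bullet> z)) + sin \<theta> * (sin \<theta> * (z \<bullet> z))"
    by (simp add: turn_def inner_add_left inner_add_right inner_quarter_turn orthogonal_quarter_turn
        inner_commute[of "quarter_turn z" z])
  also have "\<dots> = ((cos \<theta>)\<^sup>2 + (sin \<theta>)\<^sup>2) * (z \<bullet> z)"
    by (simp only: power2_eq_square distrib_right mult.assoc)
  finally have "turn \<theta> z \<bullet> turn \<theta> z = z \<bullet> z" by simp
  then show ?thesis by (simp add: norm_eq_sqrt_inner)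
qed

lemma quarter_turn_turn: "quarter_turn (turn \<theta> z) = cos \<theta> *\<^sub>R quarter_turn z - sin \<theta> *\<^sub>R z"
  using bounded_linear_quarter_turn[THEN bounded_linear.linear]
  by (simp add: turn_def linear_add linear_scale quarter_turn_quarter_turn)

text \<open>The heading is the initial heading turned by an angle \<open>\<psi>\<close> with \<open>\<psi> x 0 = 0\<close>. Measuring the angle
  from the initial heading avoids choosing a continuous argument on the circle. The initial
  vector \<open>z x\<close> may be shorter than \<open>1\<close>, so that \<open>x\<close> can range over a whole space on which
  \<open>z\<close> is continuous; only unit vectors give solutions of the original equation.\<close>

lemma driven_flow:
  fixes f :: "'x::metric_space \<Rightarrow> real \<Rightarrow> real^2" and z :: "'x \<Rightarrow> real^2"
  assumes f: "continuous_on UNIV (\<lambda>(x, t). f x t)" and K: "\<And>x t. norm (f x t) \<le> K"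
    and z: "continuous_on UNIV z" and z1: "\<And>x. norm (z x) \<le> 1"
  obtains B where "continuous_on UNIV (\<lambda>(x, t). B x t)" "\<And>x t. norm (B x t) \<le> 1"
    "\<And>x. norm (z x) = 1 \<Longrightarrow> B x 0 = z x \<and> driven (f x) (B x)"
proof -
  define g where "g = (\<lambda>x t \<psi>. f x t \<bullet> quarter_turn (turn \<psi> (z x)))"
  have fK: "\<bar>f x t \<bullet> w\<bar> \<le> max 1 K" if "norm w \<le> 1" for x t w
  proof -
    have "\<bar>f x t \<bullet> w\<bar> \<le> norm (f x t) * norm w" by (rule Cauchy_Schwarz_ineq2)
    also have "\<dots> \<le> K * 1" using K[of x t] that norm_ge_zero[of "f x t"] norm_ge_zero[of w]
      by (intro mult_mono) linarith+
    finally show ?thesis by simp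
  qed
  have turnc: "continuous_on S (\<lambda>y. turn (\<psi> y) (w y))"
    if "continuous_on S \<psi>" "continuous_on S w" for S and \<psi> :: "'b::topological_space \<Rightarrow> real" and w
  proof -
    have "continuous_on S (\<lambda>y. cos (\<psi> y))" "continuous_on S (\<lambda>y. sin (\<psi> y))"
      by (rule continuous_on_compose2[OF continuous_on_cos[OF continuous_on_id] that(1) subset_UNIV])
         (rule continuous_on_compose2[OF continuous_on_sin[OF continuous_on_id] that(1) subset_UNIV])
    moreover have "continuous_on S (\<lambda>y. quarter_turn (w y))"
      by (rule bounded_linear.continuous_on[OF bounded_linear_quarter_turn that(2)])
    ultimately show ?thesis
      unfolding turn_def by (intro continuous_on_add continuous_on_scaleR that(2))
  qed
  have gc: "continuous_on UNIV (\<lambda>(x, t, \<psi>). g x t \<psi>)"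
  proof -
    have "continuous_on UNIV (\<lambda>w::'x \<times> real \<times> real. z (fst w))"
      by (rule continuous_on_compose2[OF z]) (auto intro: continuous_on_fst continuous_on_id)
    moreover have "continuous_on UNIV (\<lambda>w::'x \<times> real \<times> real. snd (snd w))"
      by (intro continuous_intros)
    ultimately have "continuous_on UNIV
        (\<lambda>w::'x \<times> real \<times> real. quarter_turn (turn (snd (snd w)) (z (fst w))))"
      by (intro bounded_linear.continuous_on[OF bounded_linear_quarter_turn] turnc)
    moreover have "continuous_on UNIV (\<lambda>w::'x \<times> real \<times> real. (fst w, fst (snd w)))"
      by (intro continuous_intros)
    from continuous_on_compose2[OF f this]
    have "continuous_on UNIV (\<lambda>w::'x \<times> real \<times> real. f (fst w) (fst (snd w)))"
      by simp
    ultimately show ?thesis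
      unfolding g_def split_beta by (intro continuous_on_inner)
  qed
  have gb: "\<bar>g x t \<psi>\<bar> \<le> max 1 K" for x t \<psi>
    unfolding g_def by (rule fK) (simp add: norm_quarter_turn norm_turn z1)
  have gl: "\<bar>g x t \<psi> - g x t \<phi>\<bar> \<le> max 1 K * \<bar>\<psi> - \<phi>\<bar>" for x t \<psi> \<phi>
  proof -
    have components: "g x t = (\<lambda>\<theta>. cos \<theta> * (f x t \<bullet> quarter_turn (z x)) - sin \<theta> * (f x t \<bullet> z x))"
      by (rule ext) (simp add: g_def quarter_turn_turn inner_diff_right)
    have "norm (g x t \<psi> - g x t \<phi>) \<le> max 1 K * norm (\<psi> - \<phi>)"
    proof (rule field_differentiable_bound[OF convex_UNIV])
      fix \<theta>
      show "(g x t has_field_derivative - (f x t \<bullet> turn \<theta> (z x))) (at \<theta> within UNIV)"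
        unfolding components turn_def inner_add_right inner_scaleR_right
        by (rule derivative_eq_intros refl)+ (simp add: algebra_simps)
      show "norm (- (f x t \<bullet> turn \<theta> (z x))) \<le> max 1 K"
        using fK[of "turn \<theta> (z x)" x t] by (simp add: norm_turn z1)
    qed auto
    then show ?thesis by simp
  qed
  obtain \<psi> where \<psi>c: "continuous_on UNIV (\<lambda>(x, t). \<psi> x t)" and \<psi>0: "\<And>x. \<psi> x 0 = 0"
    and \<psi>: "\<And>x t. 0 \<le> t \<Longrightarrow> (\<psi> x has_real_derivative g x t (\<psi> x t)) (at t within {0..})"
    using parametrised_ode_solution[OF gc _ gb gl] by (metis max.strict_coboundedI1 zero_less_one)
  show thesis
  proof
    have "continuous_on UNIV (\<lambda>w::'x \<times> real. z (fst w))"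
      by (rule continuous_on_compose2[OF z]) (auto intro: continuous_on_fst continuous_on_id)
    with \<psi>c show "continuous_on UNIV (\<lambda>(x, t). turn (\<psi> x t) (z x))"
      unfolding split_beta by (rule turnc)
    show "norm (turn (\<psi> x t) (z x)) \<le> 1" for x t by (simp add: norm_turn z1)
    fix x assume zx: "norm (z x) = 1"
    have "driven (f x) (\<lambda>t. turn (\<psi> x t) (z x))"
      unfolding driven_def perp_proj_mult
    proof (intro allI impI conjI)
      fix t :: real assume t: "0 \<le> t"
      show n: "norm (turn (\<psi> x t) (z x)) = 1" by (simp add: norm_turn zx)
      have dc: "((\<lambda>t. cos (\<psi> x t)) has_vector_derivative - (sin (\<psi> x t) * g x t (\<psi> x t))) (at t within {0..})"
        "((\<lambda>t. sin (\<psi> x t)) has_vector_derivative cos (\<psi> x t) * g x t (\<psi> x t)) (at t within {0..})"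
        unfolding has_real_derivative_iff_has_vector_derivative[symmetric]
        by (auto intro!: derivative_eq_intros \<psi>[OF t])
      have "((\<lambda>t. turn (\<psi> x t) (z x)) has_vector_derivative
              (- (sin (\<psi> x t) * g x t (\<psi> x t))) *\<^sub>R z x
              + (cos (\<psi> x t) * g x t (\<psi> x t)) *\<^sub>R quarter_turn (z x)) (at t within {0..})"
        unfolding turn_def
        by (intro has_vector_derivative_add
            bounded_linear.has_vector_derivative[OF bounded_linear_scaleR_left] dc)
      moreover have "(- (sin (\<psi> x t) * g x t (\<psi> x t))) *\<^sub>R z x
              + (cos (\<psi> x t) * g x t (\<psi> x t)) *\<^sub>R quarter_turn (z x)
            = g x t (\<psi> x t) *\<^sub>R quarter_turn (turn (\<psi> x t) (z x))"
        by (simp add: quarter_turn_turn algebra_simps)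
      ultimately show "((\<lambda>t. turn (\<psi> x t) (z x)) has_vector_derivative
          f x t - (turn (\<psi> x t) (z x) \<bullet> f x t) *\<^sub>R turn (\<psi> x t) (z x)) (at t within {0..})"
        unfolding planar_projection[OF n] by (simp add: g_def)
    qed
    then show "turn (\<psi> x 0) (z x) = z x \<and> driven (f x) (\<lambda>t. turn (\<psi> x t) (z x))"
      by (simp add: \<psi>0 turn_def)
  qed
qed

section \<open>The cascade and its flow\<close>

lemma norm_rot_mult: "norm (rot a *v v) = norm v"
proof -
  have "rot a *v v = turn a v"
    by (simp add: rot_def turn_def quarter_turn_def matrix_vector_mult_def sum_2 vec_eq_iff forall_2)
  then show ?thesis by (simp add: norm_turn)
qed

definition drive ::
  "(nat \<times> nat) set \<Rightarrow> real^2 \<Rightarrow> (nat \<Rightarrow> nat \<Rightarrow> real) \<Rightarrow> (nat \<Rightarrow> real \<Rightarrow> real^2) \<Rightarrow> nat \<Rightarrow> real \<Rightarrow> real^2" where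
  "drive E bstar \<alpha> b i t =
     (if i = 1 then bstar else \<Sum>j\<in>in_nbrs E i. rot (\<alpha> i j) *v b j t)"

text \<open>The driving vector of agent \<open>i\<close> only involves agents of smaller index; because of this triangular
  structure the agents can be treated one after the other.\<close>

locale cascade =
  fixes n :: nat and E :: "(nat \<times> nat) set" and bstar :: "real^2" and \<alpha> :: "nat \<Rightarrow> nat \<Rightarrow> real"
  assumes root: "1 \<le> n" and nbrs: "\<And>i. i \<in> {2..n} \<Longrightarrow> in_nbrs E i \<noteq> {} \<and> in_nbrs E i \<subseteq> {1..i - 1}"
    and unit: "norm bstar = 1"
begin

abbreviation "D \<equiv> drive E bstar \<alpha>"

lemma solution_iff_driven:
  "heading_solution n E bstar \<alpha> b \<longleftrightarrow> (\<forall>i\<in>{1..n}. driven (D b i) (b i))"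
proof -
  have "{1..n} = insert 1 {2..n}" using root by auto
  then show ?thesis
    by (auto simp: heading_solution_def driven_def drive_def)
qed

lemma drive_cong:
  assumes "i \<in> {1..n}" "\<And>j. 1 \<le> j \<Longrightarrow> j < i \<Longrightarrow> b j t = c j t"
  shows "D b i t = D c i t"
proof (cases "i = 1")
  case False
  then have "in_nbrs E i \<subseteq> {1..i - 1}" using nbrs[of i] assms(1) by simp
  then have "b j t = c j t" if "j \<in> in_nbrs E i" for j using assms(2)[of j] that by fastforce
  then show ?thesis by (simp add: drive_def)
qed (simp add: drive_def)

lemma drive_bound:
  assumes "i \<in> {1..n}" "\<And>j. 1 \<le> j \<Longrightarrow> j < i \<Longrightarrow> norm (b j t) \<le> 1"
  shows "norm (D b i t) \<le> 1 + real (card (in_nbrs E i))"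
proof (cases "i = 1")
  case False
  then have "in_nbrs E i \<subseteq> {1..i - 1}" using nbrs[of i] assms(1) by simp
  then have "norm (rot (\<alpha> i j) *v b j t) \<le> 1" if "j \<in> in_nbrs E i" for j
    using assms(2)[of j] that by (fastforce simp: norm_rot_mult)
  then have "norm (\<Sum>j\<in>in_nbrs E i. rot (\<alpha> i j) *v b j t) \<le> (\<Sum>j\<in>in_nbrs E i. 1)"
    by (intro sum_norm_le)
  then show ?thesis using False by (simp add: drive_def)
qed (simp add: drive_def unit)

lemma solutions_agree:
  assumes b: "\<And>j. j \<in> {1..m} \<Longrightarrow> driven (D b j) (b j)"
    and c: "\<And>j. j \<in> {1..m} \<Longrightarrow> driven (D c j) (c j)"
    and init: "\<And>j. j \<in> {1..m} \<Longrightarrow> b j 0 = c j 0" and m: "m \<le> n"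
  shows "j \<in> {1..m} \<Longrightarrow> 0 \<le> t \<Longrightarrow> b j t = c j t"
proof (induction j arbitrary: t rule: less_induct)
  case (less j)
  have "D c j t = D b j t" if "0 \<le> t" for t
    by (rule drive_cong) (use less m that in auto)
  then have "driven (D b j) (c j)"
    using driven_cong[OF c[OF less.prems(1)]] by blast
  moreover have "norm (D b j t) \<le> 1 + real (card (in_nbrs E j))" if "0 \<le> t" for t
  proof (rule drive_bound)
    fix k assume "1 \<le> k" "k < j"
    then have "driven (D b k) (b k)" using less.prems(1) by (intro b) auto
    then show "norm (b k t) \<le> 1" using driven_norm that by fastforce
  qed (use less.prems m in auto)
  ultimately show ?case
    using driven_unique[OF b[OF less.prems(1)], of "c j" _ 0 t] init less.prems by auto
qed

lemma continuous_drive: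
  assumes "i \<in> {1..n}" "\<And>j. 1 \<le> j \<Longrightarrow> j < i \<Longrightarrow> continuous_on UNIV (\<lambda>(x, t). B j x t)"
  shows "continuous_on UNIV (\<lambda>(x::'x::metric_space, t). D (\<lambda>j. B j x) i t)"
proof (cases "i = 1")
  case False
  then have "in_nbrs E i \<subseteq> {1..i - 1}" using nbrs[of i] assms(1) by simp
  then have "continuous_on UNIV (\<lambda>z. B j (fst z) (snd z))" if "j \<in> in_nbrs E i" for j
    using assms(2)[of j] that by (fastforce simp: split_beta)
  then have "continuous_on UNIV (\<lambda>z. \<Sum>j\<in>in_nbrs E i. rot (\<alpha> i j) *v B j (fst z) (snd z))"
    by (intro continuous_on_sum bounded_linear.continuous_on[OF matrix_vector_mul_bounded_linear])
  then show ?thesis using False by (simp add: drive_def split_beta)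
qed (simp add: drive_def split_beta)

text \<open>The flow is built one agent at a time: the flow of the earlier agents is the driving vector of
  the next one, depending continuously on the initial condition and bounded by the in-degree plus one.\<close>

lemma flow_exists:
  obtains B :: "nat \<Rightarrow> (nat \<Rightarrow> real^2) \<Rightarrow> real \<Rightarrow> real^2"
  where "\<And>i. i \<in> {1..n} \<Longrightarrow> continuous_on UNIV (\<lambda>(x, t). B i x t)"
    "\<And>i x t. i \<in> {1..n} \<Longrightarrow> norm (B i x t) \<le> 1"
    "\<And>i x. i \<in> {1..n} \<Longrightarrow> norm (x i) = 1 \<Longrightarrow> B i x 0 = x i \<and> driven (D (\<lambda>j. B j x) i) (B i x)"
proof -
  define good where "good = (\<lambda>(B :: nat \<Rightarrow> (nat \<Rightarrow> real^2) \<Rightarrow> real \<Rightarrow> real^2) i.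
      continuous_on UNIV (\<lambda>(x, t). B i x t) \<and> (\<forall>x t. norm (B i x t) \<le> 1) \<and>
      (\<forall>x. norm (x i) = 1 \<longrightarrow> B i x 0 = x i \<and> driven (D (\<lambda>j. B j x) i) (B i x)))"
  have "\<exists>B. \<forall>i\<in>{1..m}. good B i" if "m \<le> n" for m
    using that
  proof (induction m)
    case 0
    show ?case by simp
  next
    case (Suc m)
    then obtain B where B: "\<And>i. i \<in> {1..m} \<Longrightarrow> good B i" by (meson Suc_leD)
    define i where "i = Suc m"
    have i: "i \<in> {1..n}" using Suc.prems by (simp add: i_def)
    \<comment> \<open>The retraction onto the unit disc: continuous everywhere and the identity on unit vectors.\<close>
    define z where "z = (\<lambda>x::nat \<Rightarrow> real^2. x i /\<^sub>R max 1 (norm (x i)))"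
    have fc: "continuous_on UNIV (\<lambda>(x, t). D (\<lambda>j. B j x) i t)"
      by (rule continuous_drive[OF i]) (use B in \<open>auto simp: good_def i_def\<close>)
    have fb: "norm (D (\<lambda>j. B j x) i t) \<le> 1 + real (card (in_nbrs E i))" for x t
      by (rule drive_bound[OF i]) (use B in \<open>auto simp: good_def i_def\<close>)
    have zc: "continuous_on UNIV z"
      unfolding z_def by (intro continuous_intros continuous_on_product_coordinates) auto
    have z1: "norm (z x) \<le> 1" for x
      by (simp add: z_def divide_simps)
    obtain C where C: "continuous_on UNIV (\<lambda>(x, t). C x t)" "\<And>x t. norm (C x t) \<le> 1"
      "\<And>x. norm (z x) = 1 \<Longrightarrow> C x 0 = z x \<and> driven (D (\<lambda>j. B j x) i) (C x)"
      using driven_flow[OF fc fb zc z1] by blast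
    have "good (B(i := C)) j" if "j \<in> {1..Suc m}" for j
    proof -
      have same: "D (\<lambda>k. (B(i := C)) k x) j = D (\<lambda>k. B k x) j" for x
        by (rule ext, rule drive_cong) (use that Suc.prems in \<open>auto simp: i_def\<close>)
      show ?thesis
      proof (cases "j = i")
        case True
        then show ?thesis unfolding good_def same using C by (simp add: z_def)
      next
        case False
        then have "good B j" using that by (intro B) (auto simp: i_def)
        then show ?thesis unfolding good_def same using False by simp
      qed
    qed
    then show ?case by blast
  qed
  from this[OF order_refl] obtain B where "\<And>i. i \<in> {1..n} \<Longrightarrow> good B i" by blast
  then show thesis by (intro that[of B]) (auto simp: good_def)
qed

end

section \<open>Null sets in products of circles\<close>

lemma circle_point_inj_on: "inj_on circle_point {-pi<..pi}"
proof (rule inj_onI)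
  fix s t assume st: "s \<in> {-pi<..pi}" "t \<in> {-pi<..pi}" and eq: "circle_point s = circle_point t"
  have "sin s = sin t" "cos s = cos t"
    using eq by (auto simp: circle_point_def vec_eq_iff forall_2)
  then obtain k :: int where k: "s = t + 2 * pi * k"
    using sin_cos_eq_iff by (metis mult.commute mult.left_commute)
  then have diff: "pi * (2 * of_int k) = s - t" by simp
  have "pi * (2 * of_int k) < pi * 2" "pi * (- 2) < pi * (2 * of_int k)"
    unfolding diff using st by auto
  then have "2 * of_int k < (2::real)" "- 2 < 2 * (of_int k :: real)"
    by (simp_all only: mult_less_cancel_left_pos[OF pi_gt_zero])
  then have "k = 0" by linarith
  then show "s = t" using k by simp
qed

lemma sets_circle_measure: "sets circle_measure = sets (restrict_space borel (sphere 0 1))"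
  by (simp add: circle_measure_def)

lemma null_sets_circle_singleton:
  assumes "z \<in> space circle_measure"
  shows "{z} \<in> null_sets circle_measure"
proof
  let ?A = "{\<theta> \<in> {-pi<..pi}. circle_point \<theta> = z}"
  have sing: "{z} \<in> sets (restrict_space borel (sphere 0 1))"
    using assms by (simp add: sets_restrict_space_iff space_circle_measure)
  then show "{z} \<in> sets circle_measure" by (simp add: sets_circle_measure)
  have "finite ?A"
  proof (cases "?A = {}")
    case False
    then obtain \<theta> where "\<theta> \<in> ?A" by blast
    then have "?A \<subseteq> {\<theta>}" using circle_point_inj_on by (auto simp: inj_on_def)
    then show ?thesis using finite_subset by blast
  next
    case True
    then show ?thesis by (simp only: finite.emptyI)
  qed
  then have fin: "emeasure lborel ?A = 0"
    by (simp add: emeasure_lborel_countable countable_finite)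
  have "emeasure circle_measure {z} = emeasure (restrict_space lborel {-pi<..pi})
          (circle_point -` {z} \<inter> space (restrict_space lborel {-pi<..pi}))"
    unfolding circle_measure_def by (rule emeasure_distr[OF measurable_circle_point sing])
  also have "circle_point -` {z} \<inter> space (restrict_space lborel {-pi<..pi}) = ?A"
    by (auto simp: space_restrict_space)
  also have "emeasure (restrict_space lborel {-pi<..pi}) ?A = emeasure lborel ?A"
    by (rule emeasure_restrict_space) auto
  finally show "emeasure circle_measure {z} = 0" using fin by simp
qed

lemma finite_measure_circle: "finite_measure circle_measure"
  by (rule finite_measureI) (simp add: space_circle_measure emeasure_circle_measure_total)

text \<open>Borel sets of the full product space can thus be used as sets of initial conditions; the
  coordinates outside \<open>I\<close> have the constant value \<open>undefined\<close>.\<close>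

lemma measurable_coordinates_to_borel:
  "(\<lambda>x. x) \<in> PiM I (\<lambda>_. circle_measure) \<rightarrow>\<^sub>M (borel :: (nat \<Rightarrow> real^2) measure)"
proof (rule measurable_coordinatewise_then_product)
  fix i
  show "(\<lambda>x. x i) \<in> borel_measurable (PiM I (\<lambda>_. circle_measure))"
  proof (cases "i \<in> I")
    case True
    have "(\<lambda>x. x) \<in> circle_measure \<rightarrow>\<^sub>M borel"
      unfolding measurable_cong_sets[OF sets_circle_measure refl]
      by (simp add: measurable_restrict_space1)
    from measurable_compose[OF measurable_component_singleton[OF True] this]
    show ?thesis .
  next
    case False
    then have "x i = undefined" if "x \<in> space (PiM I (\<lambda>_. circle_measure))" for x
      using that by (auto simp: space_PiM PiE_def extensional_def)
    then have "(\<lambda>x. x i) \<in> borel_measurable (PiM I (\<lambda>_. circle_measure)) \<longleftrightarrow>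
          (\<lambda>x. undefined) \<in> PiM I (\<lambda>_. circle_measure) \<rightarrow>\<^sub>M (borel :: (real^2) measure)"
      by (rule measurable_cong)
    then show ?thesis by simp
  qed
qed

text \<open>Continuity in \<open>x\<close> for each fixed \<open>t\<close> makes \<open>dist (F x t) l \<le> \<epsilon>\<close>, for all \<open>t \<ge> N\<close>, a closed condition
  although it involves uncountably many times; convergence is then a countable combination.\<close>

lemma borel_tendsto_at_top:
  fixes F :: "'x::topological_space \<Rightarrow> real \<Rightarrow> 'y::metric_space"
  assumes F: "\<And>t. continuous_on UNIV (\<lambda>x. F x t)"
  shows "{x. (F x \<longlongrightarrow> l) at_top} \<in> sets borel"
proof -
  have "{x. (F x \<longlongrightarrow> l) at_top} =
      (\<Inter>m::nat. \<Union>N::nat. \<Inter>t\<in>{real N..}. {x. dist (F x t) l \<le> inverse (real (Suc m))})"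
  proof (intro set_eqI iffI)
    fix x assume "x \<in> {x. (F x \<longlongrightarrow> l) at_top}"
    then have lim: "(F x \<longlongrightarrow> l) at_top" by simp
    have "\<exists>N::nat. \<forall>t\<ge>real N. dist (F x t) l \<le> inverse (real (Suc m))" for m
    proof -
      have "\<forall>\<^sub>F t in at_top. dist (F x t) l < inverse (real (Suc m))"
        using lim by (rule tendstoD) simp
      then obtain T where T: "\<And>t. T \<le> t \<Longrightarrow> dist (F x t) l < inverse (real (Suc m))"
        by (auto simp: eventually_at_top_linorder)
      obtain N :: nat where "T \<le> real N" using real_arch_simple by blast
      then show ?thesis using T by (meson less_imp_le order_trans)
    qed
    then show "x \<in> (\<Inter>m::nat. \<Union>N::nat. \<Inter>t\<in>{real N..}. {x. dist (F x t) l \<le> inverse (real (Suc m))})"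
      by (simp only: INT_iff UN_iff mem_Collect_eq atLeast_iff Ball_def Bex_def) blast
  next
    fix x assume x: "x \<in> (\<Inter>m::nat. \<Union>N::nat. \<Inter>t\<in>{real N..}. {x. dist (F x t) l \<le> inverse (real (Suc m))})"
    have "(F x \<longlongrightarrow> l) at_top"
    proof (rule tendstoI)
      fix e :: real assume "0 < e"
      then obtain m where m: "inverse (real (Suc m)) < e" using reals_Archimedean by blast
      obtain N :: nat where "\<forall>t\<ge>real N. dist (F x t) l \<le> inverse (real (Suc m))"
        using x by (simp only: INT_iff UN_iff mem_Collect_eq atLeast_iff Ball_def Bex_def) blast
      then show "\<forall>\<^sub>F t in at_top. dist (F x t) l < e"
        using m unfolding eventually_at_top_linorder by (meson le_less_trans)
    qed
    then show "x \<in> {x. (F x \<longlongrightarrow> l) at_top}" by simp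
  qed
  moreover have "closed (\<Inter>t\<in>{real N..}. {x. dist (F x t) l \<le> inverse (real (Suc m))})" for N m :: nat
    by (intro closed_INT ballI closed_Collect_le continuous_intros F)
  ultimately show ?thesis
    by (auto intro!: sets.countable_INT' sets.countable_UN borel_closed)
qed

text \<open>Fubini: integrating first over the \<open>i\<close>-th coordinate, every slice of \<open>N\<close> is at most one point and
  therefore null.\<close>

lemma AE_PiM_not_in_if_slices_subsingleton:
  fixes M :: "'i \<Rightarrow> 'a measure"
  assumes M: "product_sigma_finite M" and null: "\<And>z. z \<in> space (M i) \<Longrightarrow> {z} \<in> null_sets (M i)"
    and I: "finite I" "i \<in> I" and N: "N \<in> sets (PiM I M)"
    and slice: "\<And>x y. x \<in> N \<Longrightarrow> y \<in> N \<Longrightarrow> (\<And>j. j \<noteq> i \<Longrightarrow> x j = y j) \<Longrightarrow> x i = y i"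
  shows "AE x in PiM I M. x \<notin> N"
proof -
  interpret product_sigma_finite M by (rule M)
  have ins: "insert i (I - {i}) = I" using I by blast
  have slice0: "(\<integral>\<^sup>+ y. indicator N (x(i := y)) \<partial>M i) = (0::ennreal)" for x
  proof (cases "\<exists>z. x(i := z) \<in> N")
    case True
    then obtain z where z: "x(i := z) \<in> N" by blast
    have "y = z" if "x(i := y) \<in> N" for y
      using slice[OF that z] by simp
    then have "(\<integral>\<^sup>+ y. indicator N (x(i := y)) \<partial>M i) \<le> (\<integral>\<^sup>+ y. indicator {z} y \<partial>M i)"
      by (intro nn_integral_mono) (auto simp: indicator_def)
    also have "\<dots> = 0"
    proof -
      have "(x(i := z)) i \<in> space (M i)"
        using sets.sets_into_space[OF N] z I(2) unfolding space_PiM by (blast dest: PiE_mem)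
      then show ?thesis using null by (simp add: null_setsD1 null_setsD2)
    qed
    finally show ?thesis by simp
  qed (simp add: indicator_def)
  have "emeasure (PiM I M) N = (\<integral>\<^sup>+ x. indicator N x \<partial>PiM (insert i (I - {i})) M)"
    unfolding ins using N by simp
  also have "\<dots> = (\<integral>\<^sup>+ x. \<integral>\<^sup>+ y. indicator N (x(i := y)) \<partial>M i \<partial>PiM (I - {i}) M)"
    by (rule product_nn_integral_insert) (use I N ins in auto)
  also have "\<dots> = 0" by (simp add: slice0)
  finally show ?thesis using N by (simp add: AE_not_in null_setsI)
qed

section \<open>Almost global convergence\<close>

context cascade
begin

text \<open>The length of the limit of the driving vector when all predecessors reach their target
  directions; the root is driven by the unit vector \<open>bstar\<close> itself.\<close>

definition drive_gain :: "nat \<Rightarrow> real" where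
  "drive_gain i = (if i = 1 then 1 else real (card (in_nbrs E i)))"

lemma drive_gain_pos:
  assumes "i \<in> {1..n}"
  shows "0 < drive_gain i"
proof (cases "i = 1")
  case False
  then have "in_nbrs E i \<noteq> {}" "in_nbrs E i \<subseteq> {1..i - 1}" using nbrs[of i] assms by auto
  then show ?thesis
    using False finite_subset by (fastforce simp: drive_gain_def card_gt_0_iff)
qed (simp add: drive_gain_def)

lemma drive_tendsto:
  assumes i: "i \<in> {1..n}" and root_dir: "d 1 = bstar"
    and rel: "\<And>j. i \<noteq> 1 \<Longrightarrow> j \<in> in_nbrs E i \<Longrightarrow> d i = rot (\<alpha> i j) *v d j"
    and lim: "\<And>j. 1 \<le> j \<Longrightarrow> j < i \<Longrightarrow> (b j \<longlongrightarrow> d j) at_top"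
  shows "(D b i \<longlongrightarrow> drive_gain i *\<^sub>R d i) at_top"
proof (cases "i = 1")
  case True
  then have "D b i = (\<lambda>_. bstar)" by (simp add: drive_def fun_eq_iff)
  then show ?thesis using True root_dir by (simp add: drive_gain_def)
next
  case False
  then have sub: "in_nbrs E i \<subseteq> {1..i - 1}" using nbrs[of i] i by simp
  have "((\<lambda>t. \<Sum>j\<in>in_nbrs E i. rot (\<alpha> i j) *v b j t) \<longlongrightarrow> (\<Sum>j\<in>in_nbrs E i. d i)) at_top"
  proof (intro tendsto_sum)
    fix j assume j: "j \<in> in_nbrs E i"
    have "(b j \<longlongrightarrow> d j) at_top" using sub j False by (intro lim) fastforce+
    from bounded_linear.tendsto[OF matrix_vector_mul_bounded_linear[of "rot (\<alpha> i j)"] this]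
    show "((\<lambda>t. rot (\<alpha> i j) *v b j t) \<longlongrightarrow> d i) at_top"
      using rel[OF False j] by simp
  qed
  moreover have "D b i = (\<lambda>t. \<Sum>j\<in>in_nbrs E i. rot (\<alpha> i j) *v b j t)"
    using False by (simp add: drive_def fun_eq_iff)
  moreover have "drive_gain i *\<^sub>R d i = (\<Sum>j\<in>in_nbrs E i. d i)"
    unfolding sum_constant_scaleR using False by (simp add: drive_gain_def)
  ultimately show ?thesis by (simp only:)
qed

text \<open>Agent \<open>i\<close> fails if its driving vector converges as it should but its heading ends at the
  antipode. Outside the null set where this happens to some agent, convergence propagates from the root by
  induction. Two initial conditions in the same failure set that differ at most in coordinate \<open>i\<close> have the same
  driving vector, so repulsion from the antipode forces them to coincide.\<close>

lemma almost_global_convergence: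
  assumes d1: "\<And>i. i \<in> {1..n} \<Longrightarrow> norm (d i) = 1" and root_dir: "d 1 = bstar"
    and rel: "\<And>i j. i \<in> {2..n} \<Longrightarrow> j \<in> in_nbrs E i \<Longrightarrow> d i = rot (\<alpha> i j) *v d j"
  shows "AE x in PiM {1..n} (\<lambda>_. circle_measure).
           \<forall>b. heading_solution n E bstar \<alpha> b \<and> (\<forall>i\<in>{1..n}. b i 0 = x i) \<longrightarrow>
               (\<forall>i\<in>{1..n}. (b i \<longlongrightarrow> d i) at_top)"
proof -
  let ?M = "PiM {1..n} (\<lambda>_. circle_measure)"
  obtain B :: "nat \<Rightarrow> (nat \<Rightarrow> real^2) \<Rightarrow> real \<Rightarrow> real^2"
    where Bc: "\<And>i. i \<in> {1..n} \<Longrightarrow> continuous_on UNIV (\<lambda>(x, t). B i x t)"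
      and B1: "\<And>i x t. i \<in> {1..n} \<Longrightarrow> norm (B i x t) \<le> 1"
      and B: "\<And>i x. i \<in> {1..n} \<Longrightarrow> norm (x i) = 1 \<Longrightarrow>
                B i x 0 = x i \<and> driven (D (\<lambda>j. B j x) i) (B i x)"
    by (rule flow_exists) blast
  have Db: "norm (D (\<lambda>j. B j x) i t) \<le> 1 + real (card (in_nbrs E i))" if "i \<in> {1..n}" for i x t
    by (rule drive_bound[OF that]) (use B1 that in auto)
  have unit_coord: "norm (x i) = 1" if "x \<in> space ?M" "i \<in> {1..n}" for x i
    using PiE_mem[of x "{1..n}" "\<lambda>_. sphere 0 1" i] that by (simp add: space_PiM space_circle_measure)
  define bad where "bad = (\<lambda>i. {x. (D (\<lambda>j. B j x) i \<longlongrightarrow> drive_gain i *\<^sub>R d i) at_top}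
      \<inter> {x. (B i x \<longlongrightarrow> - d i) at_top})"
  have at_time: "continuous_on UNIV (\<lambda>x. F x t)"
    if "continuous_on UNIV (\<lambda>(x, t). F x t)" for F :: "(nat \<Rightarrow> real^2) \<Rightarrow> real \<Rightarrow> real^2" and t
    using continuous_on_compose2[OF that, of UNIV "\<lambda>x. (x, t)"] by (simp add: continuous_intros)
  have bad_borel: "bad i \<in> sets borel" if i: "i \<in> {1..n}" for i
    unfolding bad_def
    by (intro sets.Int borel_tendsto_at_top at_time continuous_drive[OF i] Bc i) (use i in auto)
  have AE_good: "AE x in ?M. x \<notin> bad i" if i: "i \<in> {1..n}" for i
  proof -
    have meas: "bad i \<inter> space ?M \<in> sets ?M"
      using measurable_sets[OF measurable_coordinates_to_borel bad_borel[OF i], of "{1..n}"]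
      by simp
    have "AE x in ?M. x \<notin> bad i \<inter> space ?M"
    proof (rule AE_PiM_not_in_if_slices_subsingleton[where i=i])
      show "product_sigma_finite (\<lambda>_::nat. circle_measure)"
        using finite_measure_circle by (simp add: product_sigma_finite_def finite_measure_def)
      fix x y
      assume x: "x \<in> bad i \<inter> space ?M" and y: "y \<in> bad i \<inter> space ?M"
        and same: "\<And>j. j \<noteq> i \<Longrightarrow> x j = y j"
      note nx = unit_coord[of x] and ny = unit_coord[of y]
      have agree: "B j x t = B j y t" if "j \<in> {1..i - 1}" "0 \<le> t" for j t
      proof (rule solutions_agree[where m="i - 1"])
        fix k assume "k \<in> {1..i - 1}"
        then have k: "k \<in> {1..n}" "k \<noteq> i" using i by auto
        show "driven (D (\<lambda>j. B j x) k) (B k x)" "driven (D (\<lambda>j. B j y) k) (B k y)"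
          using B[OF k(1)] nx ny x y k by auto
        show "B k x 0 = B k y 0"
          using B[OF k(1)] nx ny x y k same by auto
      qed (use that i in auto)
      have D_eq: "D (\<lambda>j. B j y) i t = D (\<lambda>j. B j x) i t" if "0 \<le> t" for t
        by (rule drive_cong[OF i]) (use agree that in auto)
      have "B i x 0 = B i y 0"
      proof (rule driven_antipodal_unique[OF _ _ Db[OF i]])
        show "driven (D (\<lambda>j. B j x) i) (B i x)" using B[OF i] nx i x by auto
        have "driven (D (\<lambda>j. B j y) i) (B i y)" using B[OF i] ny i y by auto
        from driven_cong[OF this D_eq] show "driven (D (\<lambda>j. B j x) i) (B i y)" .
      qed (use x y i d1 drive_gain_pos in \<open>auto simp: bad_def\<close>)
      then show "x i = y i" using B[OF i] nx ny x y i by auto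
    qed (use meas i null_sets_circle_singleton in auto)
    then show ?thesis
      using AE_space by eventually_elim auto
  qed
  have "AE x in ?M. \<forall>i\<in>{1..n}. x \<notin> bad i"
    using AE_good by (intro AE_finite_allI) auto
  then show ?thesis
    using AE_space
  proof eventually_elim
    fix x assume nbad: "\<forall>i\<in>{1..n}. x \<notin> bad i" and xs: "x \<in> space ?M"
    note nx = unit_coord[OF xs]
    have lim: "i \<in> {1..n} \<Longrightarrow> (B i x \<longlongrightarrow> d i) at_top" for i
    proof (induction i rule: less_induct)
      case (less i)
      have f: "(D (\<lambda>j. B j x) i \<longlongrightarrow> drive_gain i *\<^sub>R d i) at_top"
        by (rule drive_tendsto[where d=d, OF less.prems root_dir]) (use less rel in auto)
      have "(B i x \<longlongrightarrow> d i) at_top \<or> (B i x \<longlongrightarrow> - d i) at_top"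
        using driven_dichotomy[OF _ f drive_gain_pos d1] B less.prems nx by blast
      with nbad f less.prems show ?case by (auto simp: bad_def)
    qed
    show "\<forall>b. heading_solution n E bstar \<alpha> b \<and> (\<forall>i\<in>{1..n}. b i 0 = x i) \<longrightarrow>
               (\<forall>i\<in>{1..n}. (b i \<longlongrightarrow> d i) at_top)"
    proof (intro allI impI ballI)
      fix b i assume b: "heading_solution n E bstar \<alpha> b \<and> (\<forall>i\<in>{1..n}. b i 0 = x i)" and i: "i \<in> {1..n}"
      have "B i x t = b i t" if "0 \<le> t" for t
        by (rule solutions_agree[where m=n]) (use B nx b i that in \<open>auto simp: solution_iff_driven\<close>)
      then have "\<forall>\<^sub>F t in at_top. B i x t = b i t"
        by (auto simp: eventually_at_top_linorder)
      from Lim_transform_eventually[OF lim[OF i] this] show "(b i \<longlongrightarrow> d i) at_top" .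
    qed
  qed
qed

end

theorem theorem1:
  fixes n :: nat
    and p :: "nat \<Rightarrow> real^2"
    and E :: "(nat \<times> nat) set"
    and bstar :: "real^2"
    and \<alpha> :: "nat \<Rightarrow> nat \<Rightarrow> real"
  assumes "n \<ge> 2"
    and "E \<subseteq> {1..n} \<times> {1..n}"
    and "\<forall>i\<in>{1..n}. (1, i) \<in> E\<^sup>*"
    and "acyclic E"
    and "in_nbrs E 1 = {}"
    and "\<forall>i\<in>{2..n}. in_nbrs E i \<noteq> {} \<and> in_nbrs E i \<subseteq> {1..i - 1}"
    and "norm bstar = 1"
    and "\<forall>i\<in>{2..n}. \<forall>j\<in>in_nbrs E i. \<alpha> i j \<in> {-pi<..pi}"
    and "\<exists>q. (\<forall>i\<in>{1..n}. q \<noteq> p i) \<and>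
           bstar = (q - p 1) /\<^sub>R norm (q - p 1) \<and>
           (\<forall>i\<in>{2..n}. \<forall>j\<in>in_nbrs E i.
              (q - p i) /\<^sub>R norm (q - p i) = rot (\<alpha> i j) *v ((q - p j) /\<^sub>R norm (q - p j)))"
    and "\<forall>k::int. \<alpha> 2 1 \<noteq> 2 * pi * of_int k \<and> \<alpha> 2 1 \<noteq> pi + 2 * pi * of_int k"
  shows "AE x in PiM {1..n} (\<lambda>_. circle_measure).
           x 1 \<noteq> - bstar \<longrightarrow>
           (\<forall>b. heading_solution n E bstar \<alpha> b \<and> (\<forall>i\<in>{1..n}. b i 0 = x i) \<longrightarrow>
              (\<exists>q. \<forall>i\<in>{1..n}. q \<noteq> p i \<and>
                 (b i \<longlongrightarrow> (q - p i) /\<^sub>R norm (q - p i)) at_top) \<and>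
              (b 1 \<longlongrightarrow> bstar) at_top \<and>
              (\<forall>i\<in>{2..n}. \<forall>j\<in>in_nbrs E i.
                 ((\<lambda>t. b i t - rot (\<alpha> i j) *v b j t) \<longlongrightarrow> 0) at_top))"
proof -
  interpret cascade n E bstar \<alpha>
    using assms(1,6,7) by unfold_locales auto
  obtain q where q: "\<forall>i\<in>{1..n}. q \<noteq> p i" "bstar = (q - p 1) /\<^sub>R norm (q - p 1)"
    "\<forall>i\<in>{2..n}. \<forall>j\<in>in_nbrs E i.
       (q - p i) /\<^sub>R norm (q - p i) = rot (\<alpha> i j) *v ((q - p j) /\<^sub>R norm (q - p j))"
    using assms(9) by blast
  define d where "d = (\<lambda>i. (q - p i) /\<^sub>R norm (q - p i))"
  have rel: "d i = rot (\<alpha> i j) *v d j" if "i \<in> {2..n}" "j \<in> in_nbrs E i" for i j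
    using q(3) that unfolding d_def by blast
  have "AE x in PiM {1..n} (\<lambda>_. circle_measure).
           \<forall>b. heading_solution n E bstar \<alpha> b \<and> (\<forall>i\<in>{1..n}. b i 0 = x i) \<longrightarrow>
               (\<forall>i\<in>{1..n}. (b i \<longlongrightarrow> d i) at_top)"
    by (rule almost_global_convergence) (use q rel in \<open>auto simp: d_def\<close>)
  then show ?thesis
  proof eventually_elim
    fix x
    assume conv: "\<forall>b. heading_solution n E bstar \<alpha> b \<and> (\<forall>i\<in>{1..n}. b i 0 = x i) \<longrightarrow>
               (\<forall>i\<in>{1..n}. (b i \<longlongrightarrow> d i) at_top)"
    show "x 1 \<noteq> - bstar \<longrightarrow>
           (\<forall>b. heading_solution n E bstar \<alpha> b \<and> (\<forall>i\<in>{1..n}. b i 0 = x i) \<longrightarrow>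
              (\<exists>q. \<forall>i\<in>{1..n}. q \<noteq> p i \<and>
                 (b i \<longlongrightarrow> (q - p i) /\<^sub>R norm (q - p i)) at_top) \<and>
              (b 1 \<longlongrightarrow> bstar) at_top \<and>
              (\<forall>i\<in>{2..n}. \<forall>j\<in>in_nbrs E i.
                 ((\<lambda>t. b i t - rot (\<alpha> i j) *v b j t) \<longlongrightarrow> 0) at_top))"
    proof (intro impI allI conjI ballI)
      fix b assume "heading_solution n E bstar \<alpha> b \<and> (\<forall>i\<in>{1..n}. b i 0 = x i)"
      then have lim: "(b i \<longlongrightarrow> d i) at_top" if "i \<in> {1..n}" for i using conv that by blast
      show "\<exists>q. \<forall>i\<in>{1..n}. q \<noteq> p i \<and> (b i \<longlongrightarrow> (q - p i) /\<^sub>R norm (q - p i)) at_top"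
        using lim q(1) unfolding d_def by blast
      show "(b 1 \<longlongrightarrow> bstar) at_top"
        using lim[of 1] q(2) assms(1) by (simp add: d_def)
      fix i j assume i: "i \<in> {2..n}" and j: "j \<in> in_nbrs E i"
      have "j \<in> {1..i - 1}" using nbrs[OF i] j by blast
      then have "i \<in> {1..n}" "j \<in> {1..n}" using i by auto
      then have "((\<lambda>t. b i t - rot (\<alpha> i j) *v b j t) \<longlongrightarrow> d i - rot (\<alpha> i j) *v d j) at_top"
        by (intro tendsto_diff bounded_linear.tendsto[OF matrix_vector_mul_bounded_linear] lim)
      then show "((\<lambda>t. b i t - rot (\<alpha> i j) *v b j t) \<longlongrightarrow> 0) at_top"
        using rel[OF i j] by simp
    qed
  qed
qed

end
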